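(* Let $V$ be a vector space of finite dimension $n$ over a field $\mathbb{F}$, endowed with a symplectic form $\mathsf{s}$ of maximal rank. The symplectic group $\mathrm{Sp}(V)$ acts flag-transitively on $\Gamma=\Gamma(V)$; that is, for every set $J$ of types, $\mathrm{Sp}(V)$ is transitive on the set of flags of $\Gamma$ of type $J$.
   Context: For $U\le V$ let $U^\perp$ be its orthogonal with respect to $\mathsf{s}$ and $\mathrm{Rad}(U)=U\cap U^\perp$. Maximal rank means $\dim\mathrm{Rad}(V)=0$ if $n$ is even and $1$ if $n$ is odd. $\mathrm{Sp}(V)$ is the group of linear automorphisms of $V$ preserving $\mathsf{s}$. $\Gamma(V)$ has type set $I=\{1,\dots,n-1\}$. Its objects of type $i$ are the $i$-dimensional subspaces $U\le V$ with $U\cap\mathrm{Rad}(V)=0$ and $\dim\mathrm{Rad}(U)\le 1$. Each object is incident with itself, and objects $X,Y$ with $\dim X<\dim Y$ are incident iff $X\subseteq Y$ and $X\cap\mathrm{Rad}(Y)=0$. Distinct objects of equal dimension are not incident. A flag is a set of pairwise incident objects; its type is the set of types of its elements. *)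

theory Defs
  imports Complex_Main "HOL-Algebra.Group_Action"
begin

text \<open>
  The vector space is the whole type \<open>'b\<close>. A symplectic form is an alternating bilinear form,
  possibly degenerate; the condition \<open>form v v = 0\<close> (rather than skew-symmetry) is the one that is
  correct in every characteristic.
\<close>

locale symplectic_space = finite_dimensional_vector_space scale Basis
  for scale :: "'a::field \<Rightarrow> 'b::ab_group_add \<Rightarrow> 'b" and Basis :: "'b set" +
  fixes form :: "'b \<Rightarrow> 'b \<Rightarrow> 'a"
  assumes linear_left: "Vector_Spaces.linear scale (*) (\<lambda>u. form u v)"
    and linear_right: "Vector_Spaces.linear scale (*) (\<lambda>v. form u v)"
    and alternating: "form v v = 0"
begin

definition orthogonal :: "'b set \<Rightarrow> 'b set" where
  "orthogonal U = {v. \<forall>u\<in>U. form u v = 0}"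

definition Rad :: "'b set \<Rightarrow> 'b set" where
  "Rad U = U \<inter> orthogonal U"

definition maximal_rank :: bool where
  "maximal_rank \<longleftrightarrow> dim (Rad UNIV) = (if even (dim (UNIV :: 'b set)) then 0 else 1)"

definition Sp :: "('b \<Rightarrow> 'b) monoid" where
  "Sp = \<lparr>carrier = {g. Vector_Spaces.linear scale scale g \<and> bij g \<and>
                        (\<forall>u v. form (g u) (g v) = form u v)},
         monoid.mult = (\<circ>), one = id\<rparr>"

definition types :: "nat set" where
  "types = {1..<dim (UNIV :: 'b set)}"

definition objects :: "nat \<Rightarrow> 'b set set" where
  "objects i = {U. subspace U \<and> dim U = i \<and> U \<inter> Rad UNIV = {0} \<and> dim (Rad U) \<le> 1}"

definition incident :: "'b set \<Rightarrow> 'b set \<Rightarrow> bool" where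
  "incident X Y \<longleftrightarrow>
     X = Y \<or>
     dim X < dim Y \<and> X \<subseteq> Y \<and> X \<inter> Rad Y = {0} \<or>
     dim Y < dim X \<and> Y \<subseteq> X \<and> Y \<inter> Rad X = {0}"

text \<open>The type of an object is its dimension.\<close>

definition flags :: "nat set \<Rightarrow> 'b set set set" where
  "flags J = {F. F \<subseteq> (\<Union>i\<in>types. objects i) \<and> (\<forall>X\<in>F. \<forall>Y\<in>F. incident X Y) \<and> dim ` F = J}"

text \<open>
  The natural action on flags of type \<open>J\<close>, \<open>F \<mapsto> {g(X) | X \<in> F}\<close>. It is restricted to
  \<open>flags J\<close> because \<^locale>\<open>group_action\<close> works with extensional bijections.
\<close>

definition flag_action :: "nat set \<Rightarrow> ('b \<Rightarrow> 'b) \<Rightarrow> 'b set set \<Rightarrow> 'b set set" where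
  "flag_action J g = (\<lambda>F\<in>flags J. (\<lambda>X. g ` X) ` F)"

end

end

theory Submission
  imports Defs
begin

text \<open>
  Writing \<open>\<bottom>\<close> for orthogonals, everything rests on Witt's theorem for possibly degenerate
  alternating forms (\<open>witt_extension\<close>): if \<open>X\<close> and \<open>Y\<close> have the same dimension and radicals of the same
  dimension, then an isometry \<open>f\<close> from \<open>U \<le> X\<close> onto \<open>W \<le> Y\<close> that carries \<open>U \<inter> Rad X\<close> onto
  \<open>W \<inter> Rad Y\<close> extends to an isometry of \<open>X\<close> onto \<open>Y\<close>. Let \<open>A\<^sub>1 < \<dots> < A\<^sub>k\<close> and
  \<open>B\<^sub>1 < \<dots> < B\<^sub>k\<close> be two flags of the same type. An isometry \<open>A\<^sub>i \<rightarrow> B\<^sub>i\<close> extends to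
  \<open>A\<^bsub>i+1\<^esub> \<rightarrow> B\<^bsub>i+1\<^esub>\<close>, and finally to the whole space: by incidence \<open>A\<^sub>i\<close> avoids the radical of
  \<open>A\<^bsub>i+1\<^esub>\<close>, and as an object \<open>A\<^sub>k\<close> avoids that of the whole space, so the condition on radicals
  only asks that \<open>0\<close> be mapped to \<open>0\<close>; and the radicals of \<open>A\<^bsub>i+1\<^esub>\<close> and
  \<open>B\<^bsub>i+1\<^esub>\<close> have equal dimension because it is at most 1 and its parity is that of \<open>dim A\<^bsub>i+1\<^esub>\<close>
  (\<open>even_dim_plus_dim_Rad\<close>). The result is an element of the symplectic group that maps one flag
  to the other.

  Both Witt's theorem and the parity statement are consequences of a single dimension formula,
  \<open>dim (X \<inter> U\<bottom>) + dim U = dim X + dim (Rad X)\<close> for \<open>Rad X \<le> U \<le> X\<close> (\<open>dim_orthogonal\<close>).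
\<close>

context symplectic_space
begin

section \<open>Orthogonals and radicals\<close>

lemma form_add_left: "form (u + v) w = form u w + form v w"
  and form_scale_left: "form (scale c u) w = c * form u w"
  using linear_left[of w] by (auto simp: Vector_Spaces.linear_iff)

lemma form_add_right: "form w (u + v) = form w u + form w v"
  and form_scale_right: "form w (scale c u) = c * form w u"
  using linear_right[of w] by (auto simp: Vector_Spaces.linear_iff)

lemma form_zero_left [simp]: "form 0 w = 0"
  using form_scale_left[of 0 0 w] by simp

lemma form_zero_right [simp]: "form w 0 = 0"
  using form_scale_right[of w 0 0] by simp

lemma form_skew: "form u v = - form v u"
proof -
  have "form (u + v) (u + v) = form u v + form v u"
    by (simp only: form_add_left form_add_right) (simp add: alternating)
  then show ?thesis
    by (simp add: alternating add_eq_0_iff2)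
qed

lemma form_eq_0_commute: "form u v = 0 \<longleftrightarrow> form v u = 0"
  by (metis form_skew neg_equal_0_iff_equal)

lemma form_diff_left: "form (u - v) w = form u w - form v w"
  using form_add_left[of "u - v" v w] by (simp add: eq_diff_eq)

lemma form_diff_right: "form w (u - v) = form w u - form w v"
  using form_add_right[of w "u - v" v] by (simp add: eq_diff_eq)

lemmas form_simps = form_add_left form_add_right form_scale_left form_scale_right
  form_diff_left form_diff_right

lemma orthogonal_iff: "v \<in> orthogonal U \<longleftrightarrow> (\<forall>u\<in>U. form v u = 0)"
  by (simp add: orthogonal_def form_eq_0_commute[of v])

lemma orthogonal_antimono: "U \<subseteq> W \<Longrightarrow> orthogonal W \<subseteq> orthogonal U"
  by (auto simp: orthogonal_def)

lemma subspace_orthogonal: "subspace (orthogonal U)"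
  by (rule subspaceI) (auto simp: orthogonal_def form_simps)

lemma orthogonal_span: "orthogonal (span U) = orthogonal U"
proof
  show "orthogonal (span U) \<subseteq> orthogonal U"
    by (intro orthogonal_antimono span_superset)
  show "orthogonal U \<subseteq> orthogonal (span U)"
  proof
    fix v assume "v \<in> orthogonal U"
    then have "U \<subseteq> orthogonal {v}"
      by (auto simp: orthogonal_def form_eq_0_commute[of v])
    then have "span U \<subseteq> orthogonal {v}"
      by (intro span_minimal subspace_orthogonal)
    then show "v \<in> orthogonal (span U)"
      by (auto simp: orthogonal_def form_eq_0_commute[of _ v])
  qed
qed

lemma span_of_subspace [simp]: "subspace U \<Longrightarrow> span U = U"
  by (rule span_eq_iff[THEN iffD2])

lemma subspace_Rad: "subspace U \<Longrightarrow> subspace (Rad U)"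
  by (simp add: Rad_def subspace_inter subspace_orthogonal)

lemma dim_le_dim_orthogonal_singleton:
  assumes "subspace A"
  shows "dim A \<le> dim (A \<inter> orthogonal {u}) + 1"
proof (cases "A \<subseteq> orthogonal {u}")
  case True
  then show ?thesis by (simp add: Int_absorb2)
next
  case False
  then obtain a where a: "a \<in> A" "form u a \<noteq> 0"
    by (auto simp: orthogonal_def)
  let ?K = "A \<inter> orthogonal {u}"
  have "A \<subseteq> span (insert a ?K)"
  proof
    fix x assume "x \<in> A"
    let ?c = "form u x / form u a"
    have "x - scale ?c a \<in> A"
      using \<open>x \<in> A\<close> a assms by (intro subspace_diff subspace_scale)
    moreover have "form u (x - scale ?c a) = 0"
      using a(2) by (simp add: form_simps)
    ultimately have "x - scale ?c a \<in> ?K"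
      by (simp add: orthogonal_def)
    then show "x \<in> span (insert a ?K)"
      using span_base span_breakdown_eq by blast
  qed
  then have "dim A \<le> dim (insert a ?K)"
    by (rule dim_mono)
  also have "\<dots> \<le> dim ?K + 1"
    by (simp add: dim_insert)
  finally show ?thesis .
qed

lemma dim_le_dim_orthogonal_Un:
  assumes "finite B" "subspace X"
  shows "dim (X \<inter> orthogonal S) \<le> dim (X \<inter> orthogonal (S \<union> B)) + card B"
  using assms(1)
proof induction
  case (insert b B)
  have "X \<inter> orthogonal (S \<union> insert b B) = (X \<inter> orthogonal (S \<union> B)) \<inter> orthogonal {b}"
    by (auto simp: orthogonal_def)
  moreover have "subspace (X \<inter> orthogonal (S \<union> B))"
    using assms(2) by (intro subspace_inter subspace_orthogonal)
  ultimately show ?case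
    using insert dim_le_dim_orthogonal_singleton[of "X \<inter> orthogonal (S \<union> B)" b] by simp
qed simp

text \<open>
  Each further generator of \<open>W\<close> imposes at most one linear condition on \<open>X\<close>, so enlarging \<open>U\<close> to \<open>W\<close>
  lowers the dimension of the orthogonal in \<open>X\<close> by at most \<open>dim W - dim U\<close>.
\<close>

lemma dim_orthogonal_mono:
  assumes "subspace X" "subspace U" "subspace W" "U \<subseteq> W"
  shows "dim (X \<inter> orthogonal U) + dim U \<le> dim (X \<inter> orthogonal W) + dim W"
proof -
  obtain B where B: "finite B" "B \<subseteq> U" "independent B" "span B = U" "card B = dim U"
    using basis_subspace_exists[OF assms(2)] by blast
  obtain C where C: "B \<subseteq> C" "C \<subseteq> W" "independent C" "W \<subseteq> span C"
    using maximal_independent_subset_extend[of B W] B assms(4) by blast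
  have fC: "finite C"
    using C(3) by (rule finiteI_independent)
  have W: "span C = W" "card C = dim W"
    using C assms(3) by (simp_all add: span_subspace basis_card_eq_dim)
  have "orthogonal U = orthogonal B" "orthogonal W = orthogonal (B \<union> (C - B))"
    using orthogonal_span[of B] orthogonal_span[of C] B W C(1) by (auto simp: Un_absorb1)
  moreover have "card (C - B) = dim W - dim U" "dim U \<le> dim W"
    using B W C(1) fC by (auto simp: card_Diff_subset dim_subset assms(4))
  ultimately show ?thesis
    using dim_le_dim_orthogonal_Un[of "C - B" X B] fC assms(1) by simp
qed

text \<open>
  From \<open>Rad X\<close> to \<open>X\<close> the orthogonal in \<open>X\<close> shrinks from \<open>X\<close> to \<open>Rad X\<close>, which is the largest drop
  that \<open>dim_orthogonal_mono\<close> permits. Hence the bound is attained on both of the steps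
  \<open>Rad X \<le> U\<close> and \<open>U \<le> X\<close>.
\<close>

lemma dim_orthogonal:
  assumes "subspace X" "subspace U" "Rad X \<subseteq> U" "U \<subseteq> X"
  shows "dim (X \<inter> orthogonal U) + dim U = dim X + dim (Rad X)"
proof -
  have "X \<inter> orthogonal (Rad X) = X"
    by (auto simp: Rad_def orthogonal_def form_eq_0_commute)
  then have "dim X + dim (Rad X) \<le> dim (X \<inter> orthogonal U) + dim U"
    using dim_orthogonal_mono[of X "Rad X" U] assms subspace_Rad by simp
  moreover have "dim (X \<inter> orthogonal U) + dim U \<le> dim (Rad X) + dim X"
    using dim_orthogonal_mono[of X U X] assms by (simp add: Rad_def)
  ultimately show ?thesis by simp
qed

text \<open>
  A maximal totally isotropic subspace \<open>M\<close> of \<open>X\<close> is its own orthogonal in \<open>X\<close>, since an alternating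
  form allows every vector of that orthogonal to be added to \<open>M\<close>. The dimension formula then
  reads \<open>2 * dim M = dim X + dim (Rad X)\<close>.
\<close>

lemma even_dim_plus_dim_Rad:
  assumes "subspace X"
  shows "even (dim X + dim (Rad X))"
proof -
  define iso where "iso M \<longleftrightarrow> subspace M \<and> Rad X \<subseteq> M \<and> M \<subseteq> X \<and> M \<subseteq> orthogonal M" for M
  have "iso (Rad X)"
    using assms subspace_Rad by (auto simp: iso_def Rad_def orthogonal_def)
  moreover have "\<forall>M. iso M \<longrightarrow> dim M < dim X + 1"
    by (auto simp: iso_def less_Suc_eq_le intro: dim_subset)
  ultimately obtain M where M: "iso M" and max: "\<And>N. iso N \<Longrightarrow> dim N \<le> dim M"
    using ex_has_greatest_nat[of iso "Rad X" dim "dim X + 1"] by blast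
  have "X \<inter> orthogonal M \<subseteq> M"
  proof
    fix x assume x: "x \<in> X \<inter> orthogonal M"
    let ?N = "span (insert x M)"
    have "insert x M \<subseteq> orthogonal (insert x M)"
      using M x by (auto simp: iso_def orthogonal_def alternating form_eq_0_commute[of x])
    then have "?N \<subseteq> orthogonal ?N"
      by (simp add: orthogonal_span span_minimal subspace_orthogonal)
    moreover have "?N \<subseteq> X"
      using M x assms by (intro span_minimal) (auto simp: iso_def)
    moreover have "M \<subseteq> ?N"
      by (meson span_superset insert_subset)
    ultimately have "iso ?N"
      using M by (auto simp: iso_def)
    from max[OF this] show "x \<in> M"
      using M by (auto simp: iso_def dim_insert split: if_splits)
  qed
  then have "X \<inter> orthogonal M = M"
    using M by (auto simp: iso_def)
  then have "dim X + dim (Rad X) = dim M + dim M"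
    using dim_orthogonal[of X M] M assms by (simp add: iso_def)
  then show ?thesis by simp
qed


section \<open>Extension of isometries\<close>

text \<open>
  An isometry between subspaces is represented by a linear map of the whole space of which only
  the restriction to \<open>U\<close> matters. Injectivity does not follow from preservation of the form,
  because the form on \<open>U\<close> may be degenerate.
\<close>

definition isometry :: "('b \<Rightarrow> 'b) \<Rightarrow> 'b set \<Rightarrow> 'b set \<Rightarrow> bool" where
  "isometry f U W \<longleftrightarrow> Vector_Spaces.linear scale scale f \<and> inj_on f U \<and> f ` U = W \<and>
     (\<forall>u\<in>U. \<forall>v\<in>U. form (f u) (f v) = form u v)"

lemma finite_dimensional_pair: "finite_dimensional_vector_space_pair scale Basis scale Basis"
  by unfold_locales

lemma isometry_subspace: "isometry f U W \<Longrightarrow> subspace U \<Longrightarrow> subspace W"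
  unfolding isometry_def
  using module_hom.subspace_image linear_iff_module_hom by metis

lemma isometry_zero: "isometry f U W \<Longrightarrow> f 0 = 0"
  unfolding isometry_def linear_iff_module_hom by (blast intro: module_hom.zero)

lemma isometry_dim:
  assumes "isometry f U W" "subspace A" "A \<subseteq> U"
  shows "dim (f ` A) = dim A"
proof -
  interpret P: finite_dimensional_vector_space_pair scale Basis scale Basis
    by (rule finite_dimensional_pair)
  show ?thesis
    using assms by (intro P.dim_image_eq) (auto simp: isometry_def intro: inj_on_subset)
qed

lemma isometry_mono:
  assumes "isometry f U W" "A \<subseteq> U"
  shows "isometry f A (f ` A)"
  using assms unfolding isometry_def by (meson inj_on_subset subset_iff)

lemma isometry_orthogonal:
  assumes "isometry f U W" "A \<subseteq> U"
  shows "f ` (U \<inter> orthogonal A) = W \<inter> orthogonal (f ` A)"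
proof
  show "f ` (U \<inter> orthogonal A) \<subseteq> W \<inter> orthogonal (f ` A)"
    using assms unfolding isometry_def orthogonal_def by auto
  show "W \<inter> orthogonal (f ` A) \<subseteq> f ` (U \<inter> orthogonal A)"
  proof
    fix w assume w: "w \<in> W \<inter> orthogonal (f ` A)"
    have iso: "form (f a) (f u) = form a u" if "a \<in> U" "u \<in> U" for a u
      using assms(1) that by (simp add: isometry_def)
    obtain u where u: "u \<in> U" "w = f u"
      using assms(1) w by (auto simp: isometry_def)
    then have "u \<in> orthogonal A"
      using w assms(2) iso by (auto simp: orthogonal_def subset_iff)
    then show "w \<in> f ` (U \<inter> orthogonal A)"
      using u by blast
  qed
qed

lemma isometry_Rad:
  assumes "isometry f U W"
  shows "f ` Rad U = Rad W"
  using isometry_orthogonal[OF assms order_refl] assms by (simp add: Rad_def isometry_def)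

text \<open>
  For \<open>x\<close> outside \<open>U\<close> and \<open>y\<close> outside \<open>W\<close>,
  an isometry extends by \<open>x \<mapsto> y\<close> as soon as \<open>y\<close> pairs with \<open>W\<close> as \<open>x\<close> pairs with \<open>U\<close>: the form being
  alternating, there is no condition on the new vectors themselves.
\<close>

lemma isometry_insert:
  assumes iso: "isometry f U W" and U: "subspace U"
    and x: "x \<notin> U" and y: "y \<notin> W"
    and xy: "\<And>u. u \<in> U \<Longrightarrow> form y (f u) = form x u"
  obtains f' where "isometry f' (span (insert x U)) (span (insert y W))"
    "\<And>u. u \<in> U \<Longrightarrow> f' u = f u" "f' x = y"
proof -
  interpret P: finite_dimensional_vector_space_pair scale Basis scale Basis
    by (rule finite_dimensional_pair)
  have lf: "Vector_Spaces.linear scale scale f" and injf: "inj_on f U" and fU: "f ` U = W"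
    and ff: "\<And>u v. u \<in> U \<Longrightarrow> v \<in> U \<Longrightarrow> form (f u) (f v) = form u v"
    using iso by (auto simp: isometry_def)
  obtain B where B: "finite B" "B \<subseteq> U" "independent B" "span B = U" "card B = dim U"
    using basis_subspace_exists[OF U] by blast
  have "independent (insert x B)"
    using B x by (intro independent_insertI) auto
  then obtain g where lg: "Vector_Spaces.linear scale scale g"
    and g: "\<forall>b\<in>insert x B. g b = (if b = x then y else f b)"
    using P.linear_independent_extend[of "insert x B" "\<lambda>b. if b = x then y else f b"] by blast
  have gx: "g x = y" using g by simp
  have gU: "g u = f u" if "u \<in> U" for u
  proof (rule P.linear_eq_on[OF lg lf])
    show "u \<in> span B" using that B by simp
    show "g b = f b" if "b \<in> B" for b
      using g that B x by auto
  qed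
  have g_lin: "g (a + b) = g a + g b" "g (scale c a) = scale c (g a)" for a b c
    using lg by (auto simp: Vector_Spaces.linear_iff)
  have sp: "\<exists>u\<in>U. \<exists>k. v = u + scale k x" if v: "v \<in> span (insert x U)" for v
  proof -
    obtain k where "v - scale k x \<in> U"
      using v span_breakdown_eq[of v x U] U by auto
    then show ?thesis
      by (metis diff_add_cancel)
  qed
  have W: "subspace W" by (rule isometry_subspace[OF iso U])
  have "inj_on g (span (insert x U))"
  proof -
    have "v = 0" if v0: "v \<in> span (insert x U)" "g v = 0" for v
    proof -
      obtain u k where v: "u \<in> U" "v = u + scale k x"
        using sp v0(1) by blast
      then have fu: "f u + scale k y = 0"
        using v0(2) gU gx g_lin by simp
      have "k = 0"
      proof (rule ccontr)
        assume "k \<noteq> 0"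
        have "scale k y = - f u"
          using fu by (simp add: eq_neg_iff_add_eq_0 add.commute)
        then have "scale k y \<in> W"
          using v(1) fU W by (auto intro: subspace_neg)
        then have "scale (inverse k) (scale k y) \<in> W"
          using W by (rule subspace_scale[rotated])
        then show False using y \<open>k \<noteq> 0\<close> by simp
      qed
      then have "f u = 0" "v = u" using fu v by auto
      moreover have "f 0 = 0"
        using iso by (rule isometry_zero)
      ultimately show ?thesis
        using injf v(1) U by (metis inj_onD subspace_0)
    qed
    then show ?thesis
      using P.linear_inj_on_iff_eq_0[OF lg] by auto
  qed
  moreover have "g ` span (insert x U) = span (insert y W)"
    using P.linear_span_image[OF lg, of "insert x U"] gx gU fU by simp
  moreover have "form (g v) (g w) = form v w"
    if vw: "v \<in> span (insert x U)" "w \<in> span (insert x U)" for v w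
  proof -
    obtain u k where v: "u \<in> U" "v = u + scale k x"
      using sp vw(1) by blast
    obtain u' l where w: "u' \<in> U" "w = u' + scale l x"
      using sp vw(2) by blast
    have "form (f u) y = form u x"
      using xy[OF v(1)] form_skew by metis
    then show ?thesis
      using v w xy[OF w(1)] by (simp add: g_lin gU gx form_simps ff alternating)
  qed
  ultimately have "isometry g (span (insert x U)) (span (insert y W))"
    using lg by (auto simp: isometry_def)
  then show thesis
    using gU gx that by blast
qed

text \<open>
  The functional \<open>u \<mapsto> form x u\<close> on \<open>U\<close>, transported to \<open>W\<close> by \<open>f\<close>, is represented by a vector of \<open>Y\<close>.
  If it is not zero, its kernel \<open>K\<close> is a proper subspace of \<open>U\<close> that still contains \<open>Rad X\<close>; by the
  dimension formula the orthogonal of \<open>f ` K\<close> in \<open>Y\<close> is strictly larger than that of \<open>W\<close>. A vector in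
  the difference represents a nonzero functional with the same kernel, that is, a scalar multiple.
\<close>

lemma exists_representing_vector:
  assumes iso: "isometry f U W" and sub: "subspace X" "subspace Y" "subspace U"
    and X: "Rad X \<subseteq> U" "x \<in> X"
    and Y: "W \<subseteq> Y" "Rad Y = f ` Rad X"
  obtains y where "y \<in> Y" "\<And>u. u \<in> U \<Longrightarrow> form y (f u) = form x u"
proof -
  interpret P: finite_dimensional_vector_space_pair scale Basis scale Basis
    by (rule finite_dimensional_pair)
  define K where "K = U \<inter> orthogonal {x}"
  have K: "subspace K" "K \<subseteq> U" "Rad X \<subseteq> K"
    using X sub by (auto simp: K_def subspace_inter subspace_orthogonal Rad_def orthogonal_iff)
  have lf: "Vector_Spaces.linear scale scale f" and fU: "f ` U = W"
    using iso by (auto simp: isometry_def)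
  have f_lin: "f (a - b) = f a - f b" "f (scale c a) = scale c (f a)" for a b c
    using P.linear_diff[OF lf] P.linear_scale[OF lf] by auto
  show thesis
  proof (cases "K = U")
    case True
    then have "form 0 (f u) = form x u" if "u \<in> U" for u
      using that by (auto simp: K_def orthogonal_def)
    then show thesis using that subspace_0[OF sub(2)] by blast
  next
    case False
    have fK: "subspace (f ` K)" "f ` K \<subseteq> W"
      using K fU P.linear_subspace_image[OF lf] by auto
    have "dim K < dim U"
      using False K sub by (metis subspace_dim_equal not_less)
    then have "dim (f ` K) < dim W"
      using isometry_dim[OF iso] K sub fU by (metis order_refl)
    moreover have "dim (Y \<inter> orthogonal (f ` K)) + dim (f ` K) = dim Y + dim (Rad Y)"
      using fK Y K sub by (intro dim_orthogonal) auto
    moreover have "dim (Y \<inter> orthogonal W) + dim W = dim Y + dim (Rad Y)"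
      using Y K fU sub isometry_subspace[OF iso] by (intro dim_orthogonal) auto
    ultimately have "\<not> Y \<inter> orthogonal (f ` K) \<subseteq> Y \<inter> orthogonal W"
      using dim_subset[of "Y \<inter> orthogonal (f ` K)" "Y \<inter> orthogonal W"] by auto
    then obtain z where z: "z \<in> Y" "z \<in> orthogonal (f ` K)" "z \<notin> orthogonal W"
      by blast
    then obtain u\<^sub>1 where u1: "u\<^sub>1 \<in> U" "form z (f u\<^sub>1) \<noteq> 0"
      unfolding fU[symmetric] by (auto simp: orthogonal_iff)
    have "u\<^sub>1 \<notin> K"
      using z(2) u1(2) by (auto simp: orthogonal_iff)
    then have x1: "form x u\<^sub>1 \<noteq> 0"
      using u1(1) by (auto simp: K_def orthogonal_def)
    let ?y = "scale (form x u\<^sub>1 / form z (f u\<^sub>1)) z"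
    have "form ?y (f u) = form x u" if "u \<in> U" for u
    proof -
      let ?c = "form x u / form x u\<^sub>1"
      have "u - scale ?c u\<^sub>1 \<in> U"
        using that u1 sub by (intro subspace_diff subspace_scale)
      moreover have "form x (u - scale ?c u\<^sub>1) = 0"
        using x1 by (simp add: form_simps)
      ultimately have "u - scale ?c u\<^sub>1 \<in> K"
        by (simp add: K_def orthogonal_def)
      then have "form z (f (u - scale ?c u\<^sub>1)) = 0"
        using z(2) unfolding orthogonal_iff by blast
      then have "form z (f u) = ?c * form z (f u\<^sub>1)"
        by (simp add: f_lin form_simps)
      then show ?thesis
        using x1 u1 by (simp add: form_simps)
    qed
    moreover have "?y \<in> Y"
      using z sub by (intro subspace_scale)
    ultimately show thesis using that by blast
  qed
qed

text \<open>
  For \<open>isometry_insert\<close> the representing vector \<open>y\<close> must in addition lie outside \<open>W\<close>. If \<open>y = f u\<^sub>0\<close>,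
  then \<open>x - u\<^sub>0\<close> is a vector of \<open>X\<close> outside \<open>U\<close> that is orthogonal to \<open>U\<close>, and comparing dimensions gives
  a vector of \<open>Y\<close> outside \<open>W\<close> that is orthogonal to \<open>W\<close>; these two form the required pair.
\<close>

lemma exists_extension_pair:
  assumes iso: "isometry f U W" and sub: "subspace X" "subspace Y" "subspace U"
    and X: "Rad X \<subseteq> U" "U \<subset> X"
    and Y: "W \<subseteq> Y" "Rad Y = f ` Rad X" and dim: "dim X = dim Y"
  obtains x y where "x \<in> X - U" "y \<in> Y - W" "\<And>u. u \<in> U \<Longrightarrow> form y (f u) = form x u"
proof -
  have fU: "f ` U = W" and ff: "\<And>u v. u \<in> U \<Longrightarrow> v \<in> U \<Longrightarrow> form (f u) (f v) = form u v"
    using iso by (auto simp: isometry_def)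
  have W: "subspace W" by (rule isometry_subspace[OF iso sub(3)])
  have dims: "dim (Rad Y) = dim (Rad X)" "dim W = dim U"
    using isometry_dim[OF iso] subspace_Rad[OF sub(1)] X(1) Y(2) sub(3) fU by auto
  obtain x where x: "x \<in> X" "x \<notin> U"
    using X by blast
  obtain y where y: "y \<in> Y" "\<And>u. u \<in> U \<Longrightarrow> form y (f u) = form x u"
    using exists_representing_vector[OF iso sub X(1) x(1) Y] by blast
  show thesis
  proof (cases "y \<in> W")
    case False
    then show thesis using that x y by blast
  next
    case True
    then obtain u\<^sub>0 where u0: "u\<^sub>0 \<in> U" "y = f u\<^sub>0"
      using fU by blast
    let ?x = "x - u\<^sub>0"
    have x': "?x \<in> X - U" "?x \<in> orthogonal U"
    proof -
      have "x = ?x + u\<^sub>0" by simp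
      then show "?x \<in> X - U"
        using x u0 X sub by (metis DiffI subspace_add subspace_diff psubset_imp_subset subsetD)
      show "?x \<in> orthogonal U"
        using y(2) u0 ff by (auto simp: orthogonal_iff form_simps)
    qed
    \<comment> \<open>Otherwise the orthogonal of \<open>W\<close> in \<open>Y\<close> is \<open>Rad W\<close>, and the orthogonal of \<open>U\<close> in \<open>X\<close>, having the
      same dimension, is \<open>Rad U\<close>; but it contains \<open>x - u\<^sub>0\<close>.\<close>
    have "\<not> Y \<inter> orthogonal W \<subseteq> W"
    proof
      assume "Y \<inter> orthogonal W \<subseteq> W"
      then have "Y \<inter> orthogonal W = f ` Rad U"
        using Y(1) isometry_Rad[OF iso] by (auto simp: Rad_def)
      then have "dim (Y \<inter> orthogonal W) = dim (Rad U)"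
        using isometry_dim[OF iso subspace_Rad[OF sub(3)]] by (simp add: Rad_def)
      moreover have "dim (Y \<inter> orthogonal W) + dim W = dim Y + dim (Rad Y)"
        using Y X fU sub W by (intro dim_orthogonal) auto
      moreover have "dim (X \<inter> orthogonal U) + dim U = dim X + dim (Rad X)"
        using X sub by (intro dim_orthogonal) auto
      ultimately have "dim (X \<inter> orthogonal U) \<le> dim (Rad U)"
        using dim dims by simp
      then have "Rad U = X \<inter> orthogonal U"
        using X(2) sub
        by (intro subspace_dim_equal subspace_Rad subspace_inter subspace_orthogonal)
          (auto simp: Rad_def)
      then show False
        using x' by (auto simp: Rad_def)
    qed
    then obtain z where z: "z \<in> Y - W" "z \<in> orthogonal W"
      by blast
    have "form z (f u) = form ?x u" if "u \<in> U" for u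
      using z(2) x'(2) that fU by (auto simp: orthogonal_iff)
    then show thesis using that x' z by blast
  qed
qed

text \<open>
  Witt's theorem: the isometry is extended by one vector at a time. As long as \<open>U\<close> does not
  contain \<open>Rad X\<close>, the new vectors are taken in the radicals, where every orthogonality
  condition holds trivially; afterwards \<open>exists_extension_pair\<close> applies. The condition
  \<open>f ` (U \<inter> Rad X) = W \<inter> Rad Y\<close> is preserved by both kinds of step and ensures that \<open>Rad X\<close> and
  \<open>Rad Y\<close> are exhausted simultaneously.
\<close>

theorem witt_extension:
  assumes "isometry f U W" "subspace X" "subspace Y" "subspace U" "U \<subseteq> X" "W \<subseteq> Y"
    and "f ` (U \<inter> Rad X) = W \<inter> Rad Y" "dim X = dim Y" "dim (Rad X) = dim (Rad Y)"
  shows "\<exists>g. isometry g X Y \<and> (\<forall>u\<in>U. g u = f u)"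
  using assms
proof (induction "dim X - dim U" arbitrary: f U W rule: less_induct)
  case less
  note iso = less.prems(1) and X = less.prems(2) and Y = less.prems(3) and U = less.prems(4)
    and UX = less.prems(5) and WY = less.prems(6) and rad = less.prems(7)
    and dim = less.prems(8) and dimR = less.prems(9)
  have W: "subspace W" by (rule isometry_subspace[OF iso U])
  have fU: "f ` U = W" using iso by (simp add: isometry_def)
  have dW: "dim W = dim U"
    using isometry_dim[OF iso U] fU by simp
  show ?case
  proof (cases "U = X")
    case True
    then have "W = Y"
      using dW W Y WY dim by (intro subspace_dim_equal) auto
    then show ?thesis using iso True by blast
  next
    case False
    have "\<exists>x y. x \<in> X - U \<and> y \<in> Y - W \<and> (\<forall>u\<in>U. form y (f u) = form x u) \<and>
            (Rad X \<subseteq> U \<and> Rad Y \<subseteq> W \<or> x \<in> Rad X \<and> y \<in> Rad Y)"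
    proof (cases "Rad X \<subseteq> U")
      case True
      then have "f ` Rad X = W \<inter> Rad Y"
        using rad by (simp add: Int_absorb1)
      moreover have "dim (f ` Rad X) = dim (Rad X)"
        using isometry_dim[OF iso subspace_Rad[OF X] True] .
      ultimately have "W \<inter> Rad Y = Rad Y"
        using dimR W Y by (intro subspace_dim_equal subspace_inter subspace_Rad) auto
      then have "f ` Rad X = Rad Y" "Rad Y \<subseteq> W"
        using \<open>f ` Rad X = W \<inter> Rad Y\<close> by auto
      then show ?thesis
        using exists_extension_pair[OF iso X Y U True _ WY _ dim] UX False True by (metis psubsetI)
    next
      case False
      have "dim (U \<inter> Rad X) < dim (Rad X)"
        using False U X by (metis Int_lower1 Int_lower2 not_less subspace_Rad subspace_dim_equal
            subspace_inter)
      then have "dim (W \<inter> Rad Y) < dim (Rad Y)"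
        using isometry_dim[OF iso, of "U \<inter> Rad X"] U X subspace_Rad rad dimR
        by (simp add: subspace_inter)
      then have "\<not> Rad Y \<subseteq> W"
        by (metis Int_absorb1 less_irrefl)
      then obtain x y where xy: "x \<in> Rad X" "x \<notin> U" "y \<in> Rad Y" "y \<notin> W"
        using False by blast
      moreover have "form y (f u) = form x u" if "u \<in> U" for u
      proof -
        have "u \<in> X" "f u \<in> Y"
          using that UX WY fU by auto
        then show ?thesis
          using xy by (auto simp: Rad_def orthogonal_iff)
      qed
      ultimately show ?thesis by (auto simp: Rad_def)
    qed
    then obtain x y where x: "x \<in> X" "x \<notin> U" and y: "y \<in> Y" "y \<notin> W"
      and xy: "\<And>u. u \<in> U \<Longrightarrow> form y (f u) = form x u"
      and alt: "Rad X \<subseteq> U \<and> Rad Y \<subseteq> W \<or> x \<in> Rad X \<and> y \<in> Rad Y"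
      by blast
    let ?U = "span (insert x U)" and ?W = "span (insert y W)"
    obtain f' where iso': "isometry f' ?U ?W" and f'U: "\<And>u. u \<in> U \<Longrightarrow> f' u = f u"
      and f'x: "f' x = y"
      using isometry_insert[OF iso U x(2) y(2) xy] by blast
    have UX': "?U \<subseteq> X" and WY': "?W \<subseteq> Y"
      using x y UX WY X Y by (simp_all add: span_minimal)
    have UU': "U \<subseteq> ?U" and WW': "W \<subseteq> ?W"
      by (meson span_superset insert_subset)+
    have rad': "f' ` (?U \<inter> Rad X) = ?W \<inter> Rad Y"
      using alt
    proof
      assume R: "Rad X \<subseteq> U \<and> Rad Y \<subseteq> W"
      then have "?U \<inter> Rad X = U \<inter> Rad X" "?W \<inter> Rad Y = W \<inter> Rad Y"
        using UU' WW' by auto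
      then show ?thesis
        using rad f'U by simp
    next
      assume R: "x \<in> Rad X \<and> y \<in> Rad Y"
      have split: "span (insert a A) \<inter> R = span (insert a (A \<inter> R))"
        if "subspace A" "subspace R" "a \<in> R" for a A R
      proof -
        have "v - scale k a \<in> R \<longleftrightarrow> v \<in> R" for v k
          using that by (metis diff_add_cancel subspace_add subspace_diff subspace_scale)
        then show ?thesis
          using that subspace_inter[OF that(1,2)]
          by (auto simp: span_breakdown_eq)
      qed
      have hom: "module_hom scale scale f'"
        using iso' by (simp only: isometry_def linear_iff_module_hom)
      have "f' ` (?U \<inter> Rad X) = f' ` span (insert x (U \<inter> Rad X))"
        using split U X R subspace_Rad by simp
      also have "\<dots> = span (f' ` insert x (U \<inter> Rad X))"
        by (rule module_hom.span_image[OF hom, symmetric])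
      also have "f' ` insert x (U \<inter> Rad X) = insert y (W \<inter> Rad Y)"
        using rad f'U f'x by simp
      also have "span \<dots> = ?W \<inter> Rad Y"
        using split W Y R subspace_Rad by simp
      finally show ?thesis .
    qed
    have "dim ?U = dim U + 1"
      using x U by (simp add: dim_insert)
    moreover have "dim ?U \<le> dim X"
      using UX' by (rule dim_subset)
    ultimately have "dim X - dim ?U < dim X - dim U"
      by simp
    from less.hyps[OF this iso' X Y _ UX' WY' rad' dim dimR]
    obtain g where "isometry g X Y" "\<forall>u\<in>?U. g u = f' u"
      by auto
    then show ?thesis
      using UU' f'U by (metis subsetD)
  qed
qed


section \<open>Matching two flags\<close>

text \<open>
  A flag of type \<open>J\<close>, indexed by dimension. The ambient space \<open>X\<close> is a parameter, so that the members
  below the largest one, \<open>A m\<close>, form a chain of the same kind inside \<open>A m\<close>.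
\<close>

definition adapted_chain :: "nat set \<Rightarrow> (nat \<Rightarrow> 'b set) \<Rightarrow> 'b set \<Rightarrow> bool" where
  "adapted_chain J A X \<longleftrightarrow>
     (\<forall>j\<in>J. subspace (A j) \<and> dim (A j) = j \<and> dim (Rad (A j)) \<le> 1 \<and>
       A j \<subseteq> X \<and> A j \<inter> Rad X = {0}) \<and>
     (\<forall>i\<in>J. \<forall>j\<in>J. i < j \<longrightarrow> A i \<subseteq> A j \<and> A i \<inter> Rad (A j) = {0})"

lemma adapted_chain_member:
  assumes "adapted_chain J A X" "j \<in> J"
  shows "subspace (A j)" "dim (A j) = j" "dim (Rad (A j)) \<le> 1" "A j \<subseteq> X" "A j \<inter> Rad X = {0}"
  using assms by (simp_all add: adapted_chain_def)

lemma adapted_chain_below: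
  assumes "adapted_chain (insert m J) A X" "\<forall>j\<in>J. j < m"
  shows "adapted_chain J A (A m)"
  using assms unfolding adapted_chain_def by blast

text \<open>
  Induction on the largest type \<open>m\<close>: an isometry from \<open>A m\<close> onto \<open>B m\<close> matching the smaller members
  extends to \<open>X\<close> by Witt's theorem, since \<open>A m\<close> and \<open>B m\<close> avoid the radicals of \<open>X\<close> and \<open>Y\<close>.
\<close>

lemma isometry_matching_chains:
  assumes "finite J" "subspace X" "subspace Y" "dim X = dim Y" "dim (Rad X) = dim (Rad Y)"
    and "adapted_chain J A X" "adapted_chain J B Y"
  shows "\<exists>f. isometry f X Y \<and> (\<forall>j\<in>J. f ` A j = B j)"
  using assms
proof (induction J arbitrary: X Y rule: finite_linorder_max_induct)
  case empty
  have "isometry id {0} {0}"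
    by (auto simp: isometry_def Vector_Spaces.linear_iff vector_space_axioms)
  moreover have "{0} \<subseteq> X" "{0} \<subseteq> Y" "id ` ({0} \<inter> Rad X) = {0} \<inter> Rad Y"
    using empty.prems(1,2) by (simp_all add: subspace_0 subspace_Rad)
  ultimately obtain g where "isometry g X Y"
    using witt_extension[OF \<open>isometry id {0} {0}\<close> empty.prems(1,2) subspace_single_0]
      empty.prems(3,4) by metis
  then show ?case by blast
next
  case (insert m J)
  note A = adapted_chain_member[OF insert.prems(5) insertI1]
    and B = adapted_chain_member[OF insert.prems(6) insertI1]
  have "even (m + dim (Rad (A m)))" "even (m + dim (Rad (B m)))"
    using even_dim_plus_dim_Rad[OF A(1)] even_dim_plus_dim_Rad[OF B(1)] A(2) B(2) by simp_all
  \<comment> \<open>Two numbers of the same parity that are at most 1 agree.\<close>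
  then have "dim (Rad (A m)) = dim (Rad (B m))"
    using A(3) B(3)
    by (cases "dim (Rad (A m))"; cases "dim (Rad (B m))") (auto simp del: dim_eq_0)
  moreover have "adapted_chain J A (A m)" "adapted_chain J B (B m)"
    using adapted_chain_below insert.prems(5,6) insert.hyps(2) by blast+
  ultimately obtain f where f: "isometry f (A m) (B m)" "\<forall>j\<in>J. f ` A j = B j"
    using insert.IH[OF A(1) B(1)] A(2) B(2) by metis
  have "f 0 = 0"
    by (rule isometry_zero[OF f(1)])
  then have "f ` (A m \<inter> Rad X) = B m \<inter> Rad Y"
    using A(5) B(5) by simp
  then obtain g where g: "isometry g X Y" "\<forall>u\<in>A m. g u = f u"
    using witt_extension[OF f(1) insert.prems(1,2) A(1,4) B(4) _ insert.prems(3,4)] by metis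
  have "g ` A j = B j" if "j \<in> insert m J" for j
  proof -
    have "j = m \<or> j \<in> J \<and> j < m"
      using that insert.hyps(2) by blast
    then have "A j \<subseteq> A m"
      using insert.prems(5) unfolding adapted_chain_def by blast
    moreover have "f ` A j = B j"
      using \<open>j = m \<or> j \<in> J \<and> j < m\<close> f unfolding isometry_def by blast
    ultimately show ?thesis
      using g(2) by (metis image_cong subsetD)
  qed
  then show ?case using g(1) by blast
qed

text \<open>
  Distinct objects of equal dimension are not incident, so a flag has exactly one member of each
  of its types.
\<close>

lemma flag_adapted_chain:
  assumes "F \<in> flags J"
  obtains A where "F = A ` J" "adapted_chain J A UNIV"
proof -
  have F: "\<And>X. X \<in> F \<Longrightarrow> \<exists>i\<in>types. X \<in> objects i"
    "\<And>X Y. X \<in> F \<Longrightarrow> Y \<in> F \<Longrightarrow> incident X Y" "dim ` F = J"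
    using assms unfolding flags_def by blast+
  have inj: "inj_on dim F"
  proof (rule inj_onI)
    fix X Y assume "X \<in> F" "Y \<in> F" "dim X = dim Y"
    then show "X = Y"
      using F(2)[of X Y] by (simp add: incident_def)
  qed
  define A where "A = inv_into F dim"
  have A: "A j \<in> F" "dim (A j) = j" if "j \<in> J" for j
    using that F(3) by (auto simp: A_def inv_into_into f_inv_into_f)
  show thesis
  proof
    show "F = A ` J"
      using inv_into_image_cancel[OF inj, of F] F(3) by (simp add: A_def)
    have "subspace (A j) \<and> dim (A j) = j \<and> dim (Rad (A j)) \<le> 1 \<and> A j \<inter> Rad UNIV = {0}"
      if "j \<in> J" for j
      using F(1)[OF A(1)[OF that]] A(2)[OF that] unfolding objects_def by blast
    moreover have "A i \<subseteq> A j \<and> A i \<inter> Rad (A j) = {0}" if "i \<in> J" "j \<in> J" "i < j" for i j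
    proof -
      have "dim (A i) < dim (A j)"
        using A(2) that by simp
      then show ?thesis
        using F(2)[OF A(1)[OF that(1)] A(1)[OF that(2)]] unfolding incident_def
        by (metis less_irrefl less_asym)
    qed
    ultimately show "adapted_chain J A UNIV"
      unfolding adapted_chain_def by simp
  qed
qed

lemma carrier_Sp: "carrier Sp = {g. isometry g UNIV UNIV}"
  by (auto simp: Sp_def isometry_def bij_def)

lemma exists_Sp_mapping_flag:
  assumes "J \<subseteq> types" "F \<in> flags J" "G \<in> flags J"
  shows "\<exists>g\<in>carrier Sp. (`) g ` F = G"
proof -
  obtain A B where A: "F = A ` J" "adapted_chain J A UNIV"
    and B: "G = B ` J" "adapted_chain J B UNIV"
    using assms(2,3) by (metis flag_adapted_chain)
  have "finite J"
    using assms(1) by (auto simp: types_def intro: finite_subset)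
  then have "\<exists>g. isometry g UNIV UNIV \<and> (\<forall>j\<in>J. g ` A j = B j)"
    using A(2) B(2) by (intro isometry_matching_chains) simp_all
  then show ?thesis
    unfolding carrier_Sp A(1) B(1) by (auto simp: image_image)
qed


section \<open>The action on flags\<close>

lemma inv_Sp:
  assumes "g \<in> carrier Sp"
  shows "inv_into UNIV g \<in> carrier Sp"
proof -
  have lin: "Vector_Spaces.linear scale scale g" and bij: "bij g"
    and form: "\<And>u v. form (g u) (g v) = form u v"
    using assms by (auto simp: Sp_def)
  have "form (inv_into UNIV g u) (inv_into UNIV g v) = form u v" for u v
    using form[of "inv_into UNIV g u" "inv_into UNIV g v"] bij
    by (simp add: bij_is_surj surj_f_inv_f)
  then show ?thesis
    using inj_linear_imp_inv_linear[OF lin bij_is_inj[OF bij]] bij_imp_bij_inv[OF bij]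
    by (simp add: Sp_def)
qed

lemma group_Sp: "group Sp"
proof (rule groupI)
  fix g h assume "g \<in> carrier Sp" "h \<in> carrier Sp"
  then show "g \<otimes>\<^bsub>Sp\<^esub> h \<in> carrier Sp"
    by (auto simp: Sp_def intro: bij_comp Vector_Spaces.linear_compose)
next
  show "\<one>\<^bsub>Sp\<^esub> \<in> carrier Sp"
    by (auto simp: Sp_def linear_id)
next
  fix g assume g: "g \<in> carrier Sp"
  then have "inv_into UNIV g \<otimes>\<^bsub>Sp\<^esub> g = \<one>\<^bsub>Sp\<^esub>"
    by (auto simp: Sp_def bij_def)
  with inv_Sp[OF g] show "\<exists>h\<in>carrier Sp. h \<otimes>\<^bsub>Sp\<^esub> g = \<one>\<^bsub>Sp\<^esub>"
    by blast
qed (auto simp: Sp_def)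

lemma Sp_flag:
  assumes "g \<in> carrier Sp" "F \<in> flags J"
  shows "(`) g ` F \<in> flags J"
proof -
  have iso: "isometry g UNIV UNIV"
    using assms(1) by (simp add: carrier_Sp)
  then have inj: "inj g" and g0: "g 0 = 0"
    using isometry_zero by (auto simp: isometry_def)
  have dim: "dim (g ` U) = dim U" if "subspace U" for U
    using isometry_dim[OF iso that] by simp
  have Rad: "Rad (g ` U) = g ` Rad U" for U
    using isometry_Rad[OF isometry_mono[OF iso]] by blast
  have disj: "g ` U \<inter> Rad (g ` W) = {0} \<longleftrightarrow> U \<inter> Rad W = {0}" for U W
    unfolding Rad image_Int[OF inj, symmetric] using inj g0
    by (metis image_empty image_insert inj_image_eq_iff)
  have sub: "subspace U" if "U \<in> F" for U
    using that assms(2) by (auto simp: flags_def objects_def)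
  have "g ` U \<in> objects i" if "U \<in> objects i" for U i
  proof -
    have U: "subspace U" "dim U = i" "U \<inter> Rad UNIV = {0}" "dim (Rad U) \<le> 1"
      using that by (simp_all add: objects_def)
    have "g ` U \<inter> Rad UNIV = {0}"
      using disj[of U UNIV] U(3) iso by (simp add: isometry_def)
    moreover have "subspace (g ` U)"
      using isometry_subspace[OF isometry_mono[OF iso]] U(1) by simp
    ultimately show ?thesis
      using U by (simp add: objects_def Rad dim subspace_Rad)
  qed
  moreover have "incident (g ` U) (g ` W)" if "U \<in> F" "W \<in> F" "incident U W" for U W
    using that(3) dim[OF sub[OF that(1)]] dim[OF sub[OF that(2)]]
    by (auto simp: incident_def disj)
  moreover have "dim ` ((`) g ` F) = dim ` F"
    using dim sub by (auto simp: image_image)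
  ultimately show ?thesis
    using assms(2) unfolding flags_def by (simp add: subset_iff image_iff) blast
qed

lemma flag_action_Bij:
  assumes g: "g \<in> carrier Sp"
  shows "flag_action J g \<in> Bij (flags J)"
proof -
  have "bij g" using g by (simp add: Sp_def)
  have "bij_betw (flag_action J g) (flags J) (flags J)"
  proof (rule bij_betw_byWitness[where f' = "flag_action J (inv_into UNIV g)"])
    show "\<forall>F\<in>flags J. flag_action J (inv_into UNIV g) (flag_action J g F) = F"
      "\<forall>F\<in>flags J. flag_action J g (flag_action J (inv_into UNIV g) F) = F"
      using Sp_flag[OF g] Sp_flag[OF inv_Sp[OF g]] \<open>bij g\<close>
      by (simp_all add: flag_action_def image_image bij_is_inj bij_is_surj surj_f_inv_f)
    show "flag_action J g ` flags J \<subseteq> flags J" "flag_action J (inv_into UNIV g) ` flags J \<subseteq> flags J"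
      using Sp_flag[OF g] Sp_flag[OF inv_Sp[OF g]] by (auto simp: flag_action_def)
  qed
  then show ?thesis
    by (simp add: Bij_def flag_action_def)
qed

lemma group_hom_flag_action: "group_hom Sp (BijGroup (flags J)) (flag_action J)"
proof (intro group_hom.intro group_hom_axioms.intro homI group_Sp group_BijGroup)
  fix g assume "g \<in> carrier Sp"
  then show "flag_action J g \<in> carrier (BijGroup (flags J))"
    by (simp add: BijGroup_def flag_action_Bij)
next
  fix g h assume gh: "g \<in> carrier Sp" "h \<in> carrier Sp"
  show "flag_action J (g \<otimes>\<^bsub>Sp\<^esub> h) = flag_action J g \<otimes>\<^bsub>BijGroup (flags J)\<^esub> flag_action J h"
    using flag_action_Bij[OF gh(1)] flag_action_Bij[OF gh(2)] Sp_flag[OF gh(2)]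
    by (auto simp: BijGroup_def compose_def flag_action_def Sp_def image_comp fun_eq_iff image_image)
qed

end

theorem lemma5p1:
  fixes scale :: "'a::field \<Rightarrow> 'b::ab_group_add \<Rightarrow> 'b"
    and Basis :: "'b set"
    and s :: "'b \<Rightarrow> 'b \<Rightarrow> 'a"
  assumes "symplectic_space scale Basis s"
    and "symplectic_space.maximal_rank scale s"
  shows "\<forall>J \<subseteq> symplectic_space.types scale.
    transitive_action
      (symplectic_space.Sp scale s)
      (symplectic_space.flags scale s J)
      (symplectic_space.flag_action scale s J)"
proof (intro allI impI)
  fix J assume J: "J \<subseteq> symplectic_space.types scale"
  interpret symplectic_space scale Basis s by fact
  show "transitive_action Sp (flags J) (flag_action J)"
  proof (intro transitive_action.intro group_action.intro transitive_action_axioms.intro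
      group_hom_flag_action)
    fix F G assume "F \<in> flags J" "G \<in> flags J"
    then show "\<exists>g\<in>carrier Sp. flag_action J g F = G"
      using exists_Sp_mapping_flag[OF J] by (auto simp: flag_action_def)
  qed
qed

end
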